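(* Let $\mu_0$ be a probability measure on $\mathscr{B}(\mathbb{R})$ possessing moments of every order, let $\sigma^2=\int_{\mathbb{R}}x^2\mu_0(dx)$, and let $\mu(\cdot,t)$ be the solution of the (Fourier-transformed) Kac equation with initial datum $\mu_0$. If there is a strictly positive constant $C$ such that $$d_{\mathrm{TV}}(\mu(\cdot,t);\gamma_\sigma)\le C\,e^{-t}\qquad\text{for every }t\ge0,$$ then $$\mu_0(\cdot)=\gamma_\sigma(\cdot)+o_\sigma(\cdot),$$ where $o_\sigma$ is a finite signed measure satisfying $o_\sigma(A)=-o_\sigma(-A)$ and $\gamma_\sigma(A)+o_\sigma(A)\ge0$ for every Borel subset $A$ of $\mathbb{R}$.
   Context: Kac equation in Fourier form: for a probability measure $\mu_0$ on $\mathscr{B}(\mathbb{R})$ with characteristic function $\varphi_0(\xi)=\int e^{i\xi x}\mu_0(dx)$, consider $$\frac{\partial\varphi}{\partial t}(\xi,t)=\frac{1}{2\pi}\int_0^{2\pi}\varphi(\xi\cos\theta,t)\,\varphi(\xi\sin\theta,t)\,d\theta-\varphi(\xi,t),\qquad \varphi(\xi,0)=\varphi_0(\xi).$$ It has a unique solution $\varphi$, and for each $t\ge0$, $\varphi(\cdot,t)$ is the characteristic function of a probability measure $\mu(\cdot,t)$, called the solution with initial datum $\mu_0$. It is given by the Wild series $\varphi(\xi,t)=\sum_{n\ge1}e^{-t}(1-e^{-t})^{n-1}\hat q_n(\xi;\varphi_0)$ with $\hat q_1=\varphi_0$, $\hat q_n=\frac{1}{n-1}\sum_{k=1}^{n-1}\hat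 q_k\star\hat q_{n-k}$ $(n\ge2)$, where $(g_1\star g_2)(\xi)=\frac1{2\pi}\int_0^{2\pi}g_1(\xi\cos\theta)g_2(\xi\sin\theta)\,d\theta$. $\gamma_\sigma$ is the Gaussian distribution with mean $0$ and variance $\sigma^2$. For probability measures $P,Q$ on the Borel class $\mathscr{B}(\mathbb{R})$, $d_{\mathrm{TV}}(P;Q)=\sup_{B\in\mathscr{B}(\mathbb{R})}|P(B)-Q(B)|$. For $A\subset\mathbb{R}$, $-A=\{x:-x\in A\}$. *)

theory Defs
  imports "HOL-Probability.Probability"
begin

definition kac_star :: "(real \<Rightarrow> complex) \<Rightarrow> (real \<Rightarrow> complex) \<Rightarrow> real \<Rightarrow> complex" where
  "kac_star g h \<xi> =
     complex_of_real (1 / (2 * pi)) *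
       (CLINT \<theta>:{0..2 * pi}|lborel. g (\<xi> * cos \<theta>) * h (\<xi> * sin \<theta>))"

(* phi xi t is a pointwise classical solution on t >= 0; the time derivative at t = 0 is one-sided. *)
definition kac_equation :: "(real \<Rightarrow> complex) \<Rightarrow> (real \<Rightarrow> real \<Rightarrow> complex) \<Rightarrow> bool" where
  "kac_equation \<phi>\<^sub>0 \<phi> \<longleftrightarrow>
     (\<forall>\<xi>. \<phi> \<xi> 0 = \<phi>\<^sub>0 \<xi>) \<and>
     (\<forall>\<xi>. \<forall>t\<ge>0.
        ((\<lambda>s. \<phi> \<xi> s) has_vector_derivative
           (kac_star (\<lambda>\<eta>. \<phi> \<eta> t) (\<lambda>\<eta>. \<phi> \<eta> t) \<xi> - \<phi> \<xi> t)) (at t within {0..}))"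

definition kac_solution :: "real measure \<Rightarrow> (real \<Rightarrow> real measure) \<Rightarrow> bool" where
  "kac_solution \<mu>\<^sub>0 \<mu> \<longleftrightarrow>
     (\<forall>t\<ge>0. real_distribution (\<mu> t)) \<and>
     kac_equation (char \<mu>\<^sub>0) (\<lambda>\<xi> t. char (\<mu> t) \<xi>)"

(* normal_density 0 0 is identically 0, so the degenerate variance-0 law, a point mass,
   has to be treated separately. *)
definition gaussian :: "real \<Rightarrow> real measure" where
  "gaussian \<sigma> = (if \<sigma> = 0 then return borel 0 else density lborel (normal_density 0 \<sigma>))"

definition d_TV :: "real measure \<Rightarrow> real measure \<Rightarrow> real" where
  "d_TV P Q = (SUP B\<in>sets borel. \<bar>measure P B - measure Q B\<bar>)"

(* Values outside sets M are irrelevant. *)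
definition finite_signed_measure :: "'a measure \<Rightarrow> ('a set \<Rightarrow> real) \<Rightarrow> bool" where
  "finite_signed_measure M \<nu> \<longleftrightarrow>
     \<nu> {} = 0 \<and>
     (\<forall>A :: nat \<Rightarrow> 'a set. range A \<subseteq> sets M \<longrightarrow> disjoint_family A \<longrightarrow>
        (\<lambda>n. \<nu> (A n)) sums \<nu> (\<Union>n. A n))"

end

theory Submission
  imports Defs
begin

text \<open>
  The substitution \<open>\<theta> \<mapsto> 2\<pi> - \<theta>\<close> shows that the real part \<open>R\<close> of the solution itself solves
  the Kac equation. Put \<open>h = R - g\<close> with \<open>g\<close> the Gaussian characteristic function. Since
  \<open>g(\<xi> cos \<theta>) g(\<xi> sin \<theta>) = g(\<xi>)\<close>, the function \<open>u = e\<^sup>t h\<close> satisfies a linear equation whose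
  kernel \<open>(R + g)/2\<close> is bounded below by \<open>1/2\<close> near \<open>\<xi> = 0\<close>, uniformly in time. If some even moment
  of the initial datum differed from the Gaussian one, then by Taylor expansion at the first such
  order \<open>2n\<close> the initial value of \<open>\<plusminus>h\<close> would exceed \<open>b \<xi>\<^sup>2\<^sup>n\<close> near zero, and comparison would give
  \<open>\<plusminus>u \<ge> b e\<^sup>c\<^sup>t \<xi>\<^sup>2\<^sup>n\<close> with \<open>c > 0\<close>. This is impossible, because the total variation bound
  keeps \<open>u\<close> bounded. So all even moments are Gaussian, the Taylor series of \<open>R\<close> at time zero
  converges to \<open>g\<close>, and by Levy's uniqueness theorem the symmetrization of the initial datum is that
  of the Gaussian: the difference of the two measures is odd.
\<close>

section \<open>A comparison principle\<close>

text \<open>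
  Iterating the differential inequality gives \<open>z \<ge> - B (L t)\<^sup>k / k!\<close> for every \<open>k\<close>; no regularity of
  \<open>z\<close> in its first argument is needed.
\<close>

lemma comparison_principle:
  fixes z D :: "'a \<Rightarrow> real \<Rightarrow> real"
  assumes deriv: "\<And>x t. x \<in> S \<Longrightarrow> t \<ge> 0 \<Longrightarrow> (z x has_real_derivative D x t) (at t within {0..})"
    and init: "\<And>x. x \<in> S \<Longrightarrow> z x 0 \<ge> 0"
    and bdd: "\<And>x t. x \<in> S \<Longrightarrow> 0 \<le> t \<Longrightarrow> t \<le> T \<Longrightarrow> z x t \<ge> - B"
    and quasi: "\<And>x t M. x \<in> S \<Longrightarrow> t \<ge> 0 \<Longrightarrow> M \<ge> 0 \<Longrightarrow> (\<And>y. y \<in> S \<Longrightarrow> z y t \<ge> - M)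
      \<Longrightarrow> D x t \<ge> - (L * M)"
    and "L \<ge> 0" "x \<in> S" "0 \<le> t" "t \<le> T"
  shows "z x t \<ge> 0"
proof -
  define B' where "B' = max B 0"
  have iter: "z x t \<ge> - (B' * (L * t) ^ k / fact k)" if "x \<in> S" "0 \<le> t" "t \<le> T" for x t k
    using that
  proof (induction k arbitrary: x t)
    case 0
    then show ?case using bdd[of x t] by (simp add: B'_def)
  next
    case (Suc k)
    \<comment> \<open>The added term has derivative \<open>L\<close> times the bound of stage
      \<open>k\<close>, which is exactly the loss that \<open>quasi\<close> allows. So
      \<open>f\<close> is nondecreasing on \<open>{0..t}\<close>, and
      \<open>f 0 = z x 0\<close>.\<close>
    define f where "f s = z x s + B' * (L * s) ^ Suc k / fact (Suc k)" for s
    have df: "(f has_real_derivative D x s + L * (B' * (L * s) ^ k / fact k)) (at s within {0..})"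
      if "s \<ge> 0" for s
      unfolding f_def
      by (rule derivative_eq_intros deriv Suc.prems that refl | simp add: divide_simps del: power_Suc)+
    have "f 0 \<le> f t"
    proof (rule DERIV_nonneg_imp_increasing_open[where f = f])
      fix s assume s: "0 < s" "s < t"
      have "at s within {0..} = at s"
        using s by (intro at_within_interior) (auto simp: interior_real_atLeast)
      moreover have "D x s + L * (B' * (L * s) ^ k / fact k) \<ge> 0"
        using quasi[of x s "B' * (L * s) ^ k / fact k"] Suc s \<open>L \<ge> 0\<close>
        by (force simp: B'_def)
      ultimately show "\<exists>y. (f has_real_derivative y) (at s) \<and> 0 \<le> y"
        using df[of s] s by auto
    next
      show "continuous_on {0..t} f"
        by (rule continuous_on_subset[of "{0..}"])
          (auto simp: continuous_on_eq_continuous_within intro!: DERIV_continuous df)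
    qed (use Suc in auto)
    then show ?case
      using init[OF Suc.prems(1)] by (simp add: f_def)
  qed
  have "(\<lambda>k. - (B' * ((L * t) ^ k / fact k))) \<longlonglongrightarrow> - (B' * 0)"
    by (intro tendsto_intros) (use summable_LIMSEQ_zero[OF summable_exp[of "L*t"]] in \<open>simp add: field_simps\<close>)
  moreover have "- (B' * ((L * t) ^ k / fact k)) \<le> z x t" for k
    using iter[of x t k] assms by simp
  ultimately show ?thesis
    using LIMSEQ_le_const2 by fastforce
qed

section \<open>The real Kac equation\<close>

definition circle_avg :: "(real \<Rightarrow> real) \<Rightarrow> real" where
  "circle_avg F = (LINT \<theta>:{0..2 * pi}|lborel. F \<theta>) / (2 * pi)"

lemma circle_avg_mult_left: "circle_avg (\<lambda>\<theta>. a * F \<theta>) = a * circle_avg F"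
  by (simp add: circle_avg_def)

lemma circle_avg_ge:
  assumes "continuous_on UNIV F" "\<And>\<theta>. F \<theta> \<ge> m"
  shows "circle_avg F \<ge> m"
proof -
  have "(LINT \<theta>:{0..2 * pi}|lborel. m) \<le> (LINT \<theta>:{0..2 * pi}|lborel. F \<theta>)"
    using assms
    by (intro set_integral_mono borel_integrable_atLeastAtMost')
      (auto intro: continuous_on_subset)
  then show ?thesis
    by (simp add: circle_avg_def pos_le_divide_eq set_integral_const algebra_simps)
qed

text \<open>The mean is at most the larger of the two numbers. It will be applied to the squares of
  \<open>x * cos \<theta>\<close> and \<open>x * sin \<theta>\<close>, whose sum is
  \<open>x\<^sup>2\<close>.\<close>

lemma power_mean_le:
  fixes p q :: real
  assumes "p \<ge> 0" "q \<ge> 0"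
  shows "((p + q) / 2) ^ n \<le> p ^ n + q ^ n"
proof (cases "p \<le> q")
  case True
  then have "((p + q) / 2) ^ n \<le> q ^ n" using assms by (intro power_mono) auto
  then show ?thesis using assms by (simp add: add_increasing)
next
  case False
  then have "((p + q) / 2) ^ n \<le> p ^ n" using assms by (intro power_mono) auto
  then show ?thesis using assms by (simp add: add_increasing2)
qed

text \<open>These are the features of the real part of a solution on which the comparison arguments
  rest. The quadratic bound \<open>init\<close> concerns time zero only;
  \<open>quadratic_bound\<close> propagates it.\<close>

locale real_kac =
  fixes R :: "real \<Rightarrow> real \<Rightarrow> real" and m :: real
  assumes cont: "t \<ge> 0 \<Longrightarrow> continuous_on UNIV (\<lambda>\<xi>. R \<xi> t)"
    and bound: "t \<ge> 0 \<Longrightarrow> \<bar>R \<xi> t\<bar> \<le> 1"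
    and deriv: "t \<ge> 0 \<Longrightarrow> (R \<xi> has_real_derivative
      circle_avg (\<lambda>\<theta>. R (\<xi> * cos \<theta>) t * R (\<xi> * sin \<theta>) t) - R \<xi> t) (at t within {0..})"
    and init: "1 - R \<xi> 0 \<le> m * \<xi>\<^sup>2"
    and m_nonneg: "m \<ge> 0"
begin

lemma cont_mult:
  "t \<ge> 0 \<Longrightarrow> continuous_on UNIV (\<lambda>\<theta>. a * (R (\<xi> * cos \<theta>) t * R (\<xi> * sin \<theta>) t))"
  by (intro continuous_intros continuous_on_compose2[OF cont]) auto

text \<open>The squares of \<open>\<xi> * cos \<theta>\<close> and
  \<open>\<xi> * sin \<theta>\<close> add up to that of \<open>\<xi>\<close>, so averaging preserves
  a quadratic bound. It keeps \<open>R\<close> close to 1 around the origin, uniformly in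
  time.\<close>

lemma quadratic_bound:
  assumes "t \<ge> 0"
  shows "1 - R \<xi> t \<le> m * \<xi>\<^sup>2"
proof -
  \<comment> \<open>The factor \<open>exp t\<close> cancels the loss term \<open>- R \<xi> t\<close>
    of the equation.\<close>
  define z where "z \<xi> t = exp t * (m * \<xi>\<^sup>2 - (1 - R \<xi> t))" for \<xi> t
  define A where "A \<xi> t = circle_avg (\<lambda>\<theta>. R (\<xi> * cos \<theta>) t * R (\<xi> * sin \<theta>) t)" for \<xi> t
  define D where "D \<xi> t = exp t * (m * \<xi>\<^sup>2 - 1 + A \<xi> t)" for \<xi> t
  have "z \<xi> t \<ge> 0"
  \<comment> \<open>\<open>L = 2\<close> because the two arguments \<open>x * cos \<theta>\<close>
    and \<open>x * sin \<theta>\<close> lose at most \<open>M\<close> each; \<open>B\<close> comes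
    from the lower bound -1 on \<open>R\<close>.\<close>
  proof (rule comparison_principle[where z = z and x = \<xi> and S = UNIV and D = D and L = 2 and T = t and B = "2 * exp t"])
    fix x s :: real assume "s \<ge> 0"
    show "(z x has_real_derivative D x s) (at s within {0..})"
      unfolding z_def D_def A_def
      by (rule derivative_eq_intros deriv \<open>s \<ge> 0\<close> refl)+ (simp add: algebra_simps)
  next
    fix x s :: real assume s: "0 \<le> s" "s \<le> t"
    have "exp s * (- 2) \<le> z x s"
      unfolding z_def using mult_nonneg_nonneg[OF m_nonneg zero_le_power2[of x]] bound[OF s(1), of x]
      by (intro mult_left_mono) (auto simp: abs_le_iff)
    moreover have "exp s \<le> exp t" using s by simp
    ultimately show "- (2 * exp t) \<le> z x s" by linarith
  next
    \<comment> \<open>Dropping the product \<open>(1 - R(x cos \<theta>)) (1 - R(x sin \<theta>)) \<ge> 0\<close> leaves a linear inequality.\<close>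
    fix x s M :: real assume s: "s \<ge> 0" "M \<ge> 0" and ge: "\<And>y. y \<in> UNIV \<Longrightarrow> - M \<le> z y s"
    have lower: "exp s * (1 - m * x\<^sup>2) - 2 * M \<le> exp s * (R (x * cos \<theta>) s * R (x * sin \<theta>) s)" for \<theta>
    proof -
      let ?a = "R (x * cos \<theta>) s" and ?b = "R (x * sin \<theta>) s"
      have "(1 - ?a) * (1 - ?b) \<ge> 0"
        using bound[OF s(1), of "x * cos \<theta>"] bound[OF s(1), of "x * sin \<theta>"]
        by (intro mult_nonneg_nonneg) auto
      then have "exp s * (?a + ?b - 1) \<le> exp s * (?a * ?b)"
        by (intro mult_left_mono) (auto simp: algebra_simps)
      moreover have "exp s * (m * (x * cos \<theta>)\<^sup>2 + m * (x * sin \<theta>)\<^sup>2) = exp s * (m * x\<^sup>2)"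
        by (simp add: power_mult_distrib flip: distrib_left)
      ultimately show ?thesis
        using ge[of "x * cos \<theta>"] ge[of "x * sin \<theta>"] by (simp add: z_def algebra_simps)
    qed
    have "exp s * (1 - m * x\<^sup>2) - 2 * M \<le> exp s * A x s"
      unfolding A_def circle_avg_mult_left[symmetric]
      by (rule circle_avg_ge[OF cont_mult lower]) (use s in auto)
    then show "- (2 * M) \<le> D x s" by (simp add: D_def algebra_simps)
  qed (use init assms in \<open>auto simp: z_def\<close>)
  then show ?thesis by (simp add: z_def zero_le_mult_iff)
qed

text \<open>On a small interval a deviation of order \<open>\<xi> ^ (2 * n)\<close> decays no faster
  than \<open>exp (- (1 - c) * t)\<close> for some \<open>c > 0\<close>, which is incompatible with
  the rate \<open>exp (- t)\<close>. The sign \<open>s\<close> treats both directions of deviation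
  at once.\<close>

lemma slow_decay:
  fixes v b d s K :: real
  defines "g \<equiv> \<lambda>\<xi>. exp (- (v * \<xi>\<^sup>2))"
  assumes "v \<ge> 0" "b > 0" "d > 0" "\<bar>s\<bar> = 1"
    and start: "\<And>\<xi>. \<bar>\<xi>\<bar> \<le> d \<Longrightarrow> s * (R \<xi> 0 - g \<xi>) \<ge> b * \<xi> ^ (2 * n)"
    and decay: "\<And>\<xi> t. t \<ge> 0 \<Longrightarrow> \<bar>R \<xi> t - g \<xi>\<bar> \<le> K * exp (- t)"
  shows False
proof -
  \<comment> \<open>From \<open>e \<le> 1\<close> follows \<open>e\<^sup>2 \<le> e\<close>, and then
    \<open>(m + v) * e\<^sup>2 \<le> 1 / 2\<close>. The summand 1 keeps the denominator positive
    when \<open>m + v = 0\<close> and forces \<open>e \<le> 1\<close>.\<close>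
  define e where "e = min d (1 / (2 * (m + v) + 1))"
  have "1 / (2 * (m + v) + 1) \<le> 1"
    using \<open>v \<ge> 0\<close> m_nonneg by simp
  then have e: "0 < e" "e \<le> d" "e \<le> 1"
    using \<open>d > 0\<close> \<open>v \<ge> 0\<close> m_nonneg by (auto simp: e_def min_le_iff_disj)
  have small: "m * \<xi>\<^sup>2 \<le> 1 / 2" "v * \<xi>\<^sup>2 \<le> 1 / 2" if "\<bar>\<xi>\<bar> \<le> e" for \<xi>
  proof -
    have "\<xi>\<^sup>2 \<le> e\<^sup>2" using that by (simp add: abs_le_square_iff flip: abs_le_square_iff)
    also have "\<dots> \<le> e" using e by (simp add: power2_eq_square mult_le_cancel_left1)
    also have "\<dots> \<le> 1 / (2 * (m + v) + 1)" by (simp add: e_def)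
    finally have "(m + v) * \<xi>\<^sup>2 \<le> (m + v) * (1 / (2 * (m + v) + 1))"
      using m_nonneg \<open>v \<ge> 0\<close> by (intro mult_left_mono) auto
    also have "\<dots> \<le> 1 / 2" using m_nonneg \<open>v \<ge> 0\<close> by (simp add: field_simps)
    finally have "m * \<xi>\<^sup>2 + v * \<xi>\<^sup>2 \<le> 1 / 2" by (simp add: algebra_simps)
    then show "m * \<xi>\<^sup>2 \<le> 1 / 2" "v * \<xi>\<^sup>2 \<le> 1 / 2"
      using m_nonneg \<open>v \<ge> 0\<close> by (smt (verit) mult_nonneg_nonneg zero_le_power2)+
  qed
  have g_le: "g \<xi> \<le> 1" "0 < g \<xi>" for \<xi> using \<open>v \<ge> 0\<close> by (simp_all add: g_def)
  have g_ge: "g \<xi> \<ge> 1 / 2" if "\<bar>\<xi>\<bar> \<le> e" for \<xi>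
    using small(2)[OF that] exp_ge_add_one_self[of "- (v * \<xi>\<^sup>2)"] by (simp add: g_def)
  have R_ge: "R \<xi> t \<ge> 1 / 2" if "\<bar>\<xi>\<bar> \<le> e" "t \<ge> 0" for \<xi> t
    using small(1)[OF that(1)] quadratic_bound[OF that(2), of \<xi>] by simp
  \<comment> \<open>The Gaussian is stationary for the equation, so only a difference of products
    remains to be estimated.\<close>
  have g_mult: "g (\<xi> * cos \<theta>) * g (\<xi> * sin \<theta>) = g \<xi>" for \<xi> \<theta>
  proof -
    have "v * (\<xi> * cos \<theta>)\<^sup>2 + v * (\<xi> * sin \<theta>)\<^sup>2 = v * \<xi>\<^sup>2"
      by (simp add: power_mult_distrib flip: distrib_left)
    then show ?thesis by (simp add: g_def flip: exp_add)
  qed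

  \<comment> \<open>Half of the lower bound \<open>(1/2)\<^sup>n\<close> for \<open>cos\<^sup>2\<^sup>n \<theta> + sin\<^sup>2\<^sup>n \<theta>\<close>; the other factor \<open>1/2\<close> bounds the kernel.\<close>
  define c :: real where "c = (1 / 2) ^ n / 2"
  have "c > 0" by (simp add: c_def)
  \<comment> \<open>\<open>w\<close> is a growing barrier: by \<open>start\<close> it lies below the
    signed deviation at time zero, and its growth \<open>c * w\<close> is slow enough to be
    sustained by a kernel that is at least 1/2.\<close>
  define w where "w \<xi> t = b * exp (c * t) * \<xi> ^ (2 * n)" for \<xi> t
  have w_nonneg: "w \<xi> t \<ge> 0" for \<xi> t
    using \<open>b > 0\<close> by (simp add: w_def power_mult)
  define z where "z \<xi> t = s * exp t * (R \<xi> t - g \<xi>) - w \<xi> t" for \<xi> t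
  define A where "A \<xi> t = circle_avg (\<lambda>\<theta>. R (\<xi> * cos \<theta>) t * R (\<xi> * sin \<theta>) t)" for \<xi> t
  define D where "D \<xi> t = s * exp t * (A \<xi> t - g \<xi>) - c * w \<xi> t" for \<xi> t
  have nonneg: "z \<xi> t \<ge> 0" if "\<bar>\<xi>\<bar> \<le> e" "t \<ge> 0" for \<xi> t
  \<comment> \<open>The interval \<open>{-e..e}\<close> is mapped into itself by multiplication with
    \<open>cos \<theta>\<close> and \<open>sin \<theta>\<close>, so comparison can be carried out
    locally. \<open>B\<close> bounds the deviation by 2 and the barrier by its value at
    \<open>e\<close>.\<close>
  proof (rule comparison_principle[where z = z and x = \<xi> and S = "{-e..e}" and D = D and L = 2 and T = t
        and B = "2 * exp t + b * exp (c * t) * e ^ (2 * n)"])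
    fix x u :: real assume "u \<ge> 0"
    show "(z x has_real_derivative D x u) (at u within {0..})"
      unfolding z_def D_def A_def w_def
      by (rule derivative_eq_intros deriv \<open>u \<ge> 0\<close> refl)+ (simp add: algebra_simps)
  next
    fix x assume "x \<in> {-e..e}"
    then show "0 \<le> z x 0" using start[of x] e by (auto simp: z_def w_def abs_le_iff)
  next
    fix x u :: real assume x: "x \<in> {-e..e}" and u: "0 \<le> u" "u \<le> t"
    have "\<bar>s * exp u * (R x u - g x)\<bar> = exp u * \<bar>R x u - g x\<bar>"
      using \<open>\<bar>s\<bar> = 1\<close> by (simp add: abs_mult)
    also have "\<dots> \<le> exp t * 2"
      using u bound[OF u(1), of x] g_le[of x] by (intro mult_mono) auto
    finally have 1: "\<bar>s * exp u * (R x u - g x)\<bar> \<le> exp t * 2" .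
    have "x ^ (2 * n) \<le> e ^ (2 * n)"
      using x by (metis abs_le_iff atLeastAtMost_iff minus_le_iff power_even_abs dvd_triv_left power_mono abs_ge_zero)
    moreover have "exp (c * u) \<le> exp (c * t)" using u \<open>c > 0\<close> by simp
    ultimately have "w x u \<le> b * exp (c * t) * e ^ (2 * n)"
      unfolding w_def using \<open>b > 0\<close> by (intro mult_mono) (auto simp: power_mult)
    with 1 show "- (2 * exp t + b * exp (c * t) * e ^ (2 * n)) \<le> z x u"
      by (simp add: z_def abs_le_iff)
  next
    fix x u M :: real
    assume x: "x \<in> {-e..e}" and u: "u \<ge> 0" "M \<ge> 0"
      and ge: "\<And>y. y \<in> {-e..e} \<Longrightarrow> - M \<le> z y u"
    have lower: "s * exp u * g x + c * w x u - 2 * M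
        \<le> s * exp u * (R (x * cos \<theta>) u * R (x * sin \<theta>) u)" for \<theta>
    proof -
      define p where "p = x * cos \<theta>"
      define q where "q = x * sin \<theta>"
      have "\<bar>x\<bar> * \<bar>cos \<theta>\<bar> \<le> e * 1" "\<bar>x\<bar> * \<bar>sin \<theta>\<bar> \<le> e * 1"
        using x e by (intro mult_mono; auto simp: abs_le_iff)+
      then have pq: "\<bar>p\<bar> \<le> e" "\<bar>q\<bar> \<le> e" by (auto simp: p_def q_def abs_mult)
      \<comment> \<open>A weight in \<open>[1/2, 1]\<close> keeps at least half of the nonnegative
        part \<open>y\<close> and does not enlarge the error \<open>M\<close>.\<close>
      have kernel: "(k + l) / 2 * r \<ge> y / 2 - M"
        if "r \<ge> y - M" "y \<ge> 0" "1 / 2 \<le> k" "k \<le> 1" "1 / 2 \<le> l" "l \<le> 1" for k l r y :: real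
      proof -
        have "(k + l) / 2 * (y - M) \<le> (k + l) / 2 * r" using that by (intro mult_left_mono) auto
        moreover have "1 / 2 * y \<le> (k + l) / 2 * y" using that by (intro mult_right_mono) auto
        moreover have "(k + l) / 2 * M \<le> 1 * M" using that u by (intro mult_right_mono) auto
        ultimately show ?thesis by (simp add: algebra_simps)
      qed
      have R1: "R p u \<le> 1" "R q u \<le> 1" using bound[OF u(1)] by (auto simp: abs_le_iff)
      have 1: "(R p u + g p) / 2 * (s * exp u * (R q u - g q)) \<ge> w q u / 2 - M"
        using ge[of q] pq by (intro kernel w_nonneg R_ge g_ge g_le R1 u) (auto simp: z_def algebra_simps abs_le_iff)
      have 2: "(R q u + g q) / 2 * (s * exp u * (R p u - g p)) \<ge> w p u / 2 - M"
        using ge[of p] pq by (intro kernel w_nonneg R_ge g_ge g_le R1 u) (auto simp: z_def algebra_simps abs_le_iff)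
      \<comment> \<open>Symmetric splitting of a difference of products: each deviation is
        multiplied by the mean of \<open>R\<close> and \<open>g\<close> at the other point, which
        lies in \<open>[1/2, 1]\<close>.\<close>
      have "s * exp u * (R p u * R q u) - s * exp u * (g p * g q) =
          (R p u + g p) / 2 * (s * exp u * (R q u - g q)) +
          (R q u + g q) / 2 * (s * exp u * (R p u - g p))"
        by (simp add: field_simps)
      moreover have "c * w x u \<le> (w p u + w q u) / 2"
      proof -
        have "p\<^sup>2 + q\<^sup>2 = x\<^sup>2"
          by (simp add: p_def q_def power_mult_distrib flip: distrib_left)
        then have "(1 / 2) ^ n * x ^ (2 * n) \<le> p ^ (2 * n) + q ^ (2 * n)"
          using power_mean_le[of "p\<^sup>2" "q\<^sup>2" n] by (simp add: power_mult power_divide)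
        then have "b * exp (c * u) / 2 * ((1 / 2) ^ n * x ^ (2 * n))
            \<le> b * exp (c * u) / 2 * (p ^ (2 * n) + q ^ (2 * n))"
          using \<open>b > 0\<close> by (intro mult_left_mono) auto
        then show ?thesis by (simp add: w_def c_def field_simps)
      qed
      ultimately show ?thesis
        using 1 2 g_mult[of x \<theta>] unfolding p_def[symmetric] q_def[symmetric] by simp
    qed
    have "s * exp u * g x + c * w x u - 2 * M \<le> s * exp u * A x u"
      unfolding A_def circle_avg_mult_left[symmetric]
      by (rule circle_avg_ge[OF cont_mult lower]) (use u in auto)
    then show "- (2 * M) \<le> D x u" by (simp add: D_def algebra_simps)
  qed (use that in \<open>auto simp: abs_le_iff\<close>)
  \<comment> \<open>At the point \<open>e\<close> the barrier is positive and grows exponentially,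
    while \<open>decay\<close> bounds the deviation times \<open>exp t\<close> by the constant
    \<open>K\<close>.\<close>
  have bounded: "b * e ^ (2 * n) * exp (c * t) \<le> K" if "t \<ge> 0" for t
  proof -
    have "w e t \<le> s * exp t * (R e t - g e)"
      using nonneg[of e t] e that by (simp add: z_def)
    also have "\<dots> \<le> \<bar>s * exp t * (R e t - g e)\<bar>" by simp
    also have "\<dots> = exp t * \<bar>R e t - g e\<bar>" using \<open>\<bar>s\<bar> = 1\<close> by (simp add: abs_mult)
    also have "\<dots> \<le> exp t * (K * exp (- t))" using decay[OF that] by simp
    also have "\<dots> = K" by (simp add: exp_minus)
    finally show ?thesis by (simp add: w_def algebra_simps)
  qed
  define a where "a = b * e ^ (2 * n)"
  have "a > 0" using \<open>b > 0\<close> e by (simp add: a_def)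
  have "K \<ge> 0" using bounded[of 0] \<open>a > 0\<close> by (simp add: a_def)
  \<comment> \<open>The time \<open>K / (a * c)\<close> is chosen so that the linear lower bound for
    the exponential already exceeds \<open>K\<close>.\<close>
  have "a * (1 + c * (K / (a * c))) \<le> a * exp (c * (K / (a * c)))"
    using \<open>a > 0\<close> exp_ge_add_one_self by simp
  also have "\<dots> \<le> K"
    using bounded[of "K / (a * c)"] \<open>a > 0\<close> \<open>c > 0\<close> \<open>K \<ge> 0\<close> by (simp add: a_def)
  finally have "a + K \<le> K"
    using \<open>a > 0\<close> \<open>c > 0\<close> by (simp add: distrib_left)
  then show False using \<open>a > 0\<close> by simp
qed

end

section \<open>The real part of the Kac operator\<close>

lemma (in real_distribution) integrable_cos: "integrable M (\<lambda>x. cos (t * x))"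
  by (intro integrable_const_bound[where B = 1]) auto

lemma (in real_distribution) char_eq_cos_sin:
  "char M t = Complex (LINT x|M. cos (t * x)) (LINT x|M. sin (t * x))"
proof -
  have "integrable M (\<lambda>x. iexp (t * x))"
    by (intro integrable_const_bound[where B = 1]) auto
  then show ?thesis
    unfolding char_def complex_eq_iff by (simp add: Re_exp Im_exp flip: integral_Re integral_Im)
qed

lemma (in real_distribution) Re_char: "Re (char M t) = (LINT x|M. cos (t * x))"
  by (simp add: char_eq_cos_sin)

lemma (in real_distribution) Im_char: "Im (char M t) = (LINT x|M. sin (t * x))"
  by (simp add: char_eq_cos_sin)

lemma (in real_distribution) Im_char_minus: "Im (char M (- t)) = - Im (char M t)"
  by (simp add: Im_char)

lemma (in real_distribution) continuous_on_char: "continuous_on A (char M)"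
  by (simp add: continuous_at_imp_continuous_on isCont_char)

lemma circle_integral_reflect:
  fixes f :: "real \<Rightarrow> real"
  shows "(LINT \<theta>:{0..2 * pi}|lborel. f \<theta>) = (LINT \<theta>:{0..2 * pi}|lborel. f (2 * pi - \<theta>))"
  unfolding set_lebesgue_integral_def
  by (subst lborel_integral_real_affine[where c = "-1" and t = "2 * pi"])
    (auto intro!: Bochner_Integration.integral_cong simp: indicator_def)

text \<open>The imaginary part of a characteristic function is odd, and the reflection of the angle
  fixes the cosine and negates the sine. The product of imaginary parts therefore changes sign and
  integrates to zero.\<close>

lemma (in real_distribution) Re_kac_star_char:
  "Re (kac_star (char M) (char M) \<xi>) =
    circle_avg (\<lambda>\<theta>. Re (char M (\<xi> * cos \<theta>)) * Re (char M (\<xi> * sin \<theta>)))"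
proof -
  let ?S = "{0..2 * pi}"
  let ?f = "\<lambda>\<theta>. char M (\<xi> * cos \<theta>) * char M (\<xi> * sin \<theta>)"
  let ?r = "\<lambda>\<theta>. Re (char M (\<xi> * cos \<theta>)) * Re (char M (\<xi> * sin \<theta>))"
  let ?i = "\<lambda>\<theta>. Im (char M (\<xi> * cos \<theta>)) * Im (char M (\<xi> * sin \<theta>))"
  have cont: "continuous_on ?S (\<lambda>\<theta>. char M (\<xi> * cos \<theta>))" "continuous_on ?S (\<lambda>\<theta>. char M (\<xi> * sin \<theta>))"
    by (intro continuous_on_compose2[OF continuous_on_char[of UNIV]] continuous_intros; simp)+
  have int: "set_integrable lborel ?S ?f" "set_integrable lborel ?S ?r" "set_integrable lborel ?S ?i"
    by (intro borel_integrable_atLeastAtMost' continuous_intros cont)+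
  have "(LINT \<theta>:?S|lborel. ?i \<theta>) = (LINT \<theta>:?S|lborel. ?i (2 * pi - \<theta>))"
    by (rule circle_integral_reflect)
  also have "\<dots> = (LINT \<theta>:?S|lborel. - ?i \<theta>)"
    by (simp add: cos_diff sin_diff Im_char_minus)
  also have "\<dots> = - (LINT \<theta>:?S|lborel. ?i \<theta>)"
    by (simp add: set_lebesgue_integral_def)
  finally have zero: "(LINT \<theta>:?S|lborel. ?i \<theta>) = 0"
    by simp
  have "Re (CLINT \<theta>:?S|lborel. ?f \<theta>) = (LINT \<theta>:?S|lborel. Re (?f \<theta>))"
    using int(1) unfolding set_lebesgue_integral_def set_integrable_def
    by (simp flip: integral_Re)
  also have "\<dots> = (LINT \<theta>:?S|lborel. ?r \<theta>) - (LINT \<theta>:?S|lborel. ?i \<theta>)"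
    using int by (simp add: set_integral_diff)
  finally show ?thesis
    by (simp add: kac_star_def circle_avg_def zero)
qed

section \<open>Total variation and characteristic functions\<close>

lemma abs_measure_diff_le_d_TV:
  assumes "prob_space P" "prob_space Q" "B \<in> sets borel"
  shows "\<bar>measure P B - measure Q B\<bar> \<le> d_TV P Q"
  unfolding d_TV_def
proof (rule cSUP_upper[OF assms(3)])
  interpret P: prob_space P by fact
  interpret Q: prob_space Q by fact
  have "\<bar>measure P B - measure Q B\<bar> \<le> 1" for B
    using P.prob_le_1[of B] Q.prob_le_1[of B] measure_nonneg[of P B] measure_nonneg[of Q B] by linarith
  then show "bdd_above ((\<lambda>B. \<bar>measure P B - measure Q B\<bar>) ` sets borel)" by (intro bdd_aboveI2)
qed

text \<open>The sum counts the levels up to \<open>real N * y\<close>, so it equals the floor of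
  that number.\<close>

lemma step_approximation:
  fixes y :: real
  assumes "0 \<le> y" "y \<le> 1" "N > 0"
  shows "\<bar>y - (\<Sum>k=1..N. of_bool (real k \<le> real N * y)) / real N\<bar> \<le> 1 / real N"
proof -
  have 1: "0 \<le> real N * y" "real N * y \<le> real N * 1"
    using assms by (simp, intro mult_left_mono) auto
  define F where "F = nat \<lfloor>real N * y\<rfloor>"
  have "F \<le> N" unfolding F_def using 1 by linarith
  then have "{k \<in> {1..N}. k \<le> F} = {1..F}" by auto
  moreover have "real k \<le> real N * y \<longleftrightarrow> k \<le> F" for k
    unfolding F_def using 1 by linarith
  ultimately have "{k \<in> {1..N}. real k \<le> real N * y} = {1..F}"
    by (simp only:)
  then have "(\<Sum>k=1..N. of_bool (real k \<le> real N * y)) = real F"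
    by (simp add: of_bool_def sum.If_cases Int_def)
  moreover have "\<bar>real N * y - real F\<bar> \<le> 1"
    unfolding F_def using 1 by linarith
  moreover have "y - real F / real N = (real N * y - real F) / real N"
    using assms by (simp add: field_simps)
  ultimately show ?thesis
    using assms by (simp add: divide_right_mono)
qed

text \<open>Discretized layer-cake formula: \<open>f\<close> is within \<open>1 / N\<close> of the
  average of the indicators of its \<open>N\<close> superlevel sets, and each of these contributes
  at most \<open>d_TV P Q / N\<close>. Then \<open>N\<close> tends to infinity.\<close>

lemma integral_diff_le_d_TV:
  fixes f :: "real \<Rightarrow> real"
  assumes "real_distribution P" "real_distribution Q"
    and [measurable]: "f \<in> borel_measurable borel" and f: "\<And>x. 0 \<le> f x" "\<And>x. f x \<le> 1"
  shows "\<bar>(LINT x|P. f x) - (LINT x|Q. f x)\<bar> \<le> d_TV P Q"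
proof -
  define B where "B N k = {x. real k \<le> real N * f x}" for N k
  have B [measurable]: "B N k \<in> sets borel" for N k unfolding B_def by measurable
  have approx: "\<bar>(LINT x|M. f x) - (\<Sum>k=1..N. measure M (B N k)) / real N\<bar> \<le> 1 / real N"
    if "real_distribution M" "N > 0" for M N
  proof -
    interpret real_distribution M by fact
    let ?s = "\<lambda>x. (\<Sum>k=1..N. indicator (B N k) x) / real N"
    have int: "integrable M f" using f by (intro integrable_const_bound[where B = 1]) auto
    have ints: "integrable M ?s" by (auto intro!: integrable_real_indicator simp: emeasure_eq_measure)
    have *: "\<bar>f x - ?s x\<bar> \<le> 1 / real N" for x
      using step_approximation[of "f x" N] f[of x] that
      by (simp add: indicator_def B_def of_bool_def)
    have "(LINT x|M. ?s x) = (\<Sum>k=1..N. measure M (B N k)) / real N"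
      by (subst integral_divide_zero, subst Bochner_Integration.integral_sum)
         (auto intro!: integrable_real_indicator simp: emeasure_eq_measure)
    then have "(LINT x|M. f x) - (\<Sum>k=1..N. measure M (B N k)) / real N = (LINT x|M. f x - ?s x)"
      using int ints by (subst Bochner_Integration.integral_diff) auto
    also have "\<bar>\<dots>\<bar> \<le> (LINT x|M. \<bar>f x - ?s x\<bar>)" by (rule integral_abs_bound)
    also have "\<dots> \<le> (LINT x|M. 1 / real N)"
      using int ints * by (intro integral_mono) auto
    finally show ?thesis by (simp add: prob_space del: space_eq_univ)
  qed
  have step: "\<bar>(LINT x|P. f x) - (LINT x|Q. f x)\<bar> \<le> d_TV P Q + 2 * (1 / real (Suc N))" for N
  proof -
    let ?N = "Suc N"
    interpret P: real_distribution P by fact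
    interpret Q: real_distribution Q by fact
    have "\<bar>(\<Sum>k=1..?N. measure P (B ?N k)) - (\<Sum>k=1..?N. measure Q (B ?N k))\<bar>
        \<le> (\<Sum>k=1..?N. \<bar>measure P (B ?N k) - measure Q (B ?N k)\<bar>)"
      unfolding sum_subtractf[symmetric] by (rule sum_abs)
    also have "\<dots> \<le> (\<Sum>k=1..?N. d_TV P Q)"
      by (intro sum_mono abs_measure_diff_le_d_TV B P.prob_space_axioms Q.prob_space_axioms)
    also have "\<dots> = real ?N * d_TV P Q" by simp
    finally have "\<bar>(\<Sum>k=1..?N. measure P (B ?N k)) / ?N - (\<Sum>k=1..?N. measure Q (B ?N k)) / ?N\<bar> \<le> d_TV P Q"
      unfolding diff_divide_distrib[symmetric] abs_divide by (simp add: pos_divide_le_eq mult.commute)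
    then show ?thesis
      using approx[OF assms(1), of ?N] approx[OF assms(2), of ?N] by simp
  qed
  have "(\<lambda>N. d_TV P Q + 2 * (1 / real (Suc N))) \<longlonglongrightarrow> d_TV P Q + 2 * 0"
    by (intro tendsto_intros LIMSEQ_Suc[OF lim_1_over_n])
  then have "\<bar>(LINT x|P. f x) - (LINT x|Q. f x)\<bar> \<le> d_TV P Q + 2 * 0"
    by (rule LIMSEQ_le_const) (intro exI[of _ 0] allI impI step)
  then show ?thesis by simp
qed

lemma (in real_distribution) integral_half_one_plus_cos:
  "(LINT x|M. (1 + cos (t * x)) / 2) = (1 + Re (char M t)) / 2"
proof -
  have "(LINT x|M. 1 + cos (t * x)) = (LINT x|M. 1) + (LINT x|M. cos (t * x))"
    by (rule Bochner_Integration.integral_add[OF _ integrable_cos]) simp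
  also have "\<dots> = 1 + Re (char M t)"
    by (simp add: Re_char prob_space del: space_eq_univ)
  finally show ?thesis by simp
qed

text \<open>The factor 2 is the length of the range of the cosine, which is rescaled into
  \<open>[0, 1]\<close>.\<close>

lemma Re_char_diff_le_d_TV:
  assumes "real_distribution P" "real_distribution Q"
  shows "\<bar>Re (char P t) - Re (char Q t)\<bar> \<le> 2 * d_TV P Q"
proof -
  have "\<bar>(LINT x|P. (1 + cos (t * x)) / 2) - (LINT x|Q. (1 + cos (t * x)) / 2)\<bar> \<le> d_TV P Q"
  proof (rule integral_diff_le_d_TV[where f = "\<lambda>x. (1 + cos (t * x)) / 2", OF assms])
    fix x :: real
    have "0 \<le> 1 + cos (t * x)"
      using cos_ge_minus_one[of "t * x"] by linarith
    then show "0 \<le> (1 + cos (t * x)) / 2" by simp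
    show "(1 + cos (t * x)) / 2 \<le> 1" by simp
  qed measurable
  then have "\<bar>(1 + Re (char P t)) / 2 - (1 + Re (char Q t)) / 2\<bar> \<le> d_TV P Q"
    unfolding assms[THEN real_distribution.integral_half_one_plus_cos] .
  then show ?thesis by (auto simp: abs_le_iff field_simps)
qed

section \<open>Symmetrization\<close>

text \<open>The law of a variable distributed as \<open>M\<close>, multiplied by an independent fair
  sign.\<close>

definition symmetrize :: "real measure \<Rightarrow> real measure" where
  "symmetrize M = distr (measure_pmf (pmf_of_set {1, -1 :: real}) \<Otimes>\<^sub>M M) borel (\<lambda>(s, x). s * x)"

context real_distribution
begin

lemma measurable_sign_mult [measurable]:
  "(\<lambda>(s, x). s * x) \<in> borel_measurable (measure_pmf (pmf_of_set {1, -1 :: real}) \<Otimes>\<^sub>M M)"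
proof -
  have "(\<lambda>p. fst p * snd p :: real) \<in> borel_measurable (measure_pmf (pmf_of_set {1, -1 :: real}) \<Otimes>\<^sub>M M)"
    by (intro borel_measurable_times) (auto intro: measurable_compose[OF measurable_fst] measurable_compose[OF measurable_snd])
  then show ?thesis by (simp add: case_prod_beta')
qed

lemma real_distribution_symmetrize: "real_distribution (symmetrize M)"
proof -
  interpret S: pair_prob_space "measure_pmf (pmf_of_set {1, -1 :: real})" M ..
  show ?thesis
    unfolding symmetrize_def by (rule S.real_distribution_distr) measurable
qed

lemma integral_symmetrize:
  fixes f :: "real \<Rightarrow> 'b :: {banach, second_countable_topology}"
  assumes [measurable]: "f \<in> borel_measurable borel" and bdd: "\<And>x. norm (f x) \<le> B"
  shows "(LINT x|symmetrize M. f x) = (LINT x|M. f x + f (- x)) /\<^sub>R 2"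
proof -
  interpret S: pair_prob_space "measure_pmf (pmf_of_set {1, -1 :: real})" M ..
  let ?U = "measure_pmf (pmf_of_set {1, -1 :: real})"
  have int: "integrable M (\<lambda>x. f (s * x))" for s
    using bdd by (intro integrable_const_bound[where B = B]) auto
  have "(LINT x|symmetrize M. f x) = (LINT p|(?U \<Otimes>\<^sub>M M). f (case p of (s, x) \<Rightarrow> s * x))"
    unfolding symmetrize_def by (rule integral_distr) measurable
  also have "\<dots> = (LINT s|?U. LINT x|M. f (s * x))"
  proof (subst S.integral_fst'[symmetric])
    show "integrable (?U \<Otimes>\<^sub>M M) (\<lambda>p. f (case p of (s, x) \<Rightarrow> s * x))"
      using bdd by (intro S.integrable_const_bound[where B = B]) auto
  qed simp
  also have "\<dots> = (LINT x|M. f x + f (- x)) /\<^sub>R 2"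
    using int[of 1] int[of "-1"]
    by (subst integral_measure_pmf[of "{1, -1}"]) (auto simp: algebra_simps)
  finally show ?thesis .
qed

lemma measure_symmetrize:
  assumes [measurable]: "A \<in> sets borel"
  shows "measure (symmetrize M) A = (measure M A + measure M (uminus ` A)) / 2"
proof -
  interpret S: real_distribution "symmetrize M" by (rule real_distribution_symmetrize)
  have eq: "uminus ` A = uminus -` A"
    by force
  have m: "uminus ` A \<in> sets borel"
    unfolding eq using measurable_sets[of uminus borel borel A] by simp
  have ind: "indicator A (- x) = (indicator (uminus ` A) x :: real)" for x
    unfolding eq by (simp add: indicator_def)
  have "measure (symmetrize M) A = (LINT x|symmetrize M. indicator A x)" by simp
  also have "\<dots> = (LINT x|M. indicator A x + indicator A (- x)) /\<^sub>R 2"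
    by (rule integral_symmetrize[where B = 1]) (auto simp: indicator_def)
  also have "\<dots> = (measure M A + measure M (uminus ` A)) / 2"
    using m unfolding ind
    by (subst Bochner_Integration.integral_add)
      (auto intro!: integrable_real_indicator simp: emeasure_eq_measure)
  finally show ?thesis .
qed

lemma char_symmetrize: "char (symmetrize M) t = of_real (Re (char M t))"
proof -
  have "char (symmetrize M) t = (LINT x|M. iexp (t * x) + iexp (t * (- x))) /\<^sub>R 2"
    unfolding char_def by (rule integral_symmetrize[where B = 1]) auto
  also have "(\<lambda>x. iexp (t * x) + iexp (t * (- x))) = (\<lambda>x. of_real (2 * cos (t * x)))"
    by (auto simp: complex_eq_iff Re_exp Im_exp)
  also have "(LINT x|M. complex_of_real (2 * cos (t * x))) /\<^sub>R 2 = of_real (Re (char M t))"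
    by (simp add: Re_char scaleR_conv_of_real)
  finally show ?thesis .
qed

end

text \<open>The real part of a characteristic function is the characteristic function of the
  symmetrized law, so Levy uniqueness identifies the two symmetrizations.\<close>

lemma Re_char_eq_imp_measure_sum_eq:
  assumes "real_distribution P" "real_distribution Q" "\<And>t. Re (char P t) = Re (char Q t)"
    and "A \<in> sets borel"
  shows "measure P A + measure P (uminus ` A) = measure Q A + measure Q (uminus ` A)"
proof -
  interpret P: real_distribution P by fact
  interpret Q: real_distribution Q by fact
  have "symmetrize P = symmetrize Q"
    using assms by (intro Levy_uniqueness P.real_distribution_symmetrize Q.real_distribution_symmetrize)
      (auto simp: P.char_symmetrize Q.char_symmetrize)
  then show ?thesis
    using P.measure_symmetrize[OF assms(4)] Q.measure_symmetrize[OF assms(4)] by simp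
qed

section \<open>The Gaussian law\<close>

text \<open>Scaling the standard normal law covers the point mass at \<open>\<sigma> = 0\<close> and
  negative \<open>\<sigma>\<close> uniformly, and transfers the known moments and characteristic
  function.\<close>

lemma gaussian_eq_distr: "gaussian \<sigma> = distr std_normal_distribution borel (\<lambda>x. \<sigma> * x)"
proof (cases "\<sigma> = 0")
  case True
  interpret real_distribution std_normal_distribution by (rule real_dist_normal_dist)
  show ?thesis using True by (simp add: gaussian_def distr_const)
next
  case False
  interpret real_distribution std_normal_distribution by (rule real_dist_normal_dist)
  have "distributed std_normal_distribution lborel (\<lambda>x. x) std_normal_density"
    by (simp add: distributed_def distr_id2)
  from normal_density_affine[OF this zero_less_one False, of 0]
  have "distr std_normal_distribution lborel (\<lambda>x. \<sigma> * x) = density lborel (normal_density 0 \<bar>\<sigma>\<bar>)"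
    by (simp add: distributed_def)
  moreover have "normal_density 0 \<bar>\<sigma>\<bar> = normal_density 0 \<sigma>"
    by (simp add: normal_density_def fun_eq_iff)
  moreover have "distr std_normal_distribution lborel (\<lambda>x. \<sigma> * x) = distr std_normal_distribution borel (\<lambda>x. \<sigma> * x)"
    by (intro distr_cong) auto
  ultimately show ?thesis using False by (simp add: gaussian_def)
qed

lemma real_distribution_gaussian: "real_distribution (gaussian \<sigma>)"
  unfolding gaussian_eq_distr
  by (intro prob_space.real_distribution_distr prob_space_normal_density) auto

lemma char_gaussian: "char (gaussian \<sigma>) t = of_real (exp (- (\<sigma>\<^sup>2 / 2 * t\<^sup>2)))"
proof -
  have "char (gaussian \<sigma>) t = char std_normal_distribution (t * \<sigma>)"
    unfolding gaussian_eq_distr char_def by (subst integral_distr) (auto simp: mult.assoc)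
  then show ?thesis by (simp add: char_std_normal_distribution power_mult_distrib mult.commute)
qed

lemma integrable_gaussian_power: "integrable (gaussian \<sigma>) (\<lambda>x. x ^ k)"
  unfolding gaussian_eq_distr
  by (subst integrable_distr_eq)
    (auto simp: power_mult_distrib intro!: integrable_mult_right integrable_std_normal_distribution_moment)

text \<open>Written so that the Taylor terms of the characteristic function become those of an
  exponential series.\<close>

lemma gaussian_even_moment:
  "(LINT x|gaussian \<sigma>. x ^ (2 * k)) = fact (2 * k) * (\<sigma>\<^sup>2 / 2) ^ k / fact k"
proof -
  have "(LINT x|gaussian \<sigma>. x ^ (2 * k)) = (LINT x|std_normal_distribution. \<sigma> ^ (2 * k) * x ^ (2 * k))"
    unfolding gaussian_eq_distr by (subst integral_distr) (auto simp: power_mult_distrib)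
  also have "\<dots> = \<sigma> ^ (2 * k) * (fact (2 * k) / (2 ^ k * fact k))"
    by (simp only: integral_mult_right_zero std_normal_distribution_even_moments)
  also have "\<dots> = fact (2 * k) * (\<sigma>\<^sup>2 / 2) ^ k / fact k"
    by (simp add: power_mult power_divide)
  finally show ?thesis .
qed

section \<open>Moments and decay\<close>

context real_distribution
begin

text \<open>Taylor expansion to degree \<open>2 * n\<close>: the odd terms are purely imaginary and
  drop out. The remainder has the same order as the last term kept.\<close>

lemma Re_char_approx:
  assumes "\<And>k. integrable M (\<lambda>x. x ^ k)"
  shows "\<bar>Re (char M t) - (\<Sum>j\<le>n. (-1) ^ j * t ^ (2 * j) / fact (2 * j) * expectation (\<lambda>x. x ^ (2 * j)))\<bar>
    \<le> 2 * t ^ (2 * n) / fact (2 * n) * expectation (\<lambda>x. x ^ (2 * n))"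
proof -
  let ?c = "\<lambda>k. ((\<i> * t) ^ k / fact k) * expectation (\<lambda>x. x ^ k)"
  have even: "Re (?c (2 * j)) = (-1) ^ j * t ^ (2 * j) / fact (2 * j) * expectation (\<lambda>x. x ^ (2 * j))"
    and odd: "Re (?c (Suc (2 * j))) = 0" for j
  proof -
    have pow: "(\<i> * t) ^ (2 * j) = of_real ((-1) ^ j * t ^ (2 * j))"
      unfolding power_mult by (simp add: power_mult_distrib flip: power_mult_distrib[of "-1"])
    then have "?c (2 * j) = of_real ((-1) ^ j * t ^ (2 * j) / fact (2 * j) * expectation (\<lambda>x. x ^ (2 * j)))"
      by simp
    then show "Re (?c (2 * j)) = (-1) ^ j * t ^ (2 * j) / fact (2 * j) * expectation (\<lambda>x. x ^ (2 * j))"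
      by (simp only: Re_complex_of_real)
    have "?c (Suc (2 * j)) = \<i> * of_real (t * ((-1) ^ j * t ^ (2 * j)) / fact (Suc (2 * j))
        * expectation (\<lambda>x. x ^ Suc (2 * j)))"
      using pow by (simp add: algebra_simps del: fact_Suc)
    then show "Re (?c (Suc (2 * j))) = 0"
      by (simp only: Re_i_times Im_complex_of_real)
  qed
  have sum: "Re (\<Sum>k\<le>2 * n. ?c k) =
      (\<Sum>j\<le>n. (-1) ^ j * t ^ (2 * j) / fact (2 * j) * expectation (\<lambda>x. x ^ (2 * j)))"
  proof (induction n)
    case 0
    show ?case using even[of 0] by simp
  next
    case (Suc n)
    have "(\<Sum>k\<le>2 * Suc n. ?c k) = (\<Sum>k\<le>2 * n. ?c k) + ?c (Suc (2 * n)) + ?c (2 * Suc n)"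
      by simp
    then have "Re (\<Sum>k\<le>2 * Suc n. ?c k) = Re (\<Sum>k\<le>2 * n. ?c k) + Re (?c (2 * Suc n))"
      unfolding plus_complex.sel odd by (simp only: plus_complex.sel odd)
    then show ?case unfolding Suc even by (simp only: sum.atMost_Suc)
  qed
  have "\<bar>Re (char M t - (\<Sum>k\<le>2 * n. ?c k))\<bar> \<le> cmod (char M t - (\<Sum>k\<le>2 * n. ?c k))"
    by (rule abs_Re_le_cmod)
  also have "\<dots> \<le> (2 * \<bar>t\<bar> ^ (2 * n) / fact (2 * n)) * expectation (\<lambda>x. \<bar>x\<bar> ^ (2 * n))"
    by (rule char_approx1) (rule assms)
  finally show ?thesis
    unfolding minus_complex.sel sum by (simp add: power_even_abs)
qed

end

text \<open>The lower Taylor terms cancel and the term of order \<open>2 * n\<close> survives with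
  nonzero coefficient. Expanding one even order further makes the remainder negligible against it
  near the origin.\<close>

lemma Re_char_diff_leading_term:
  assumes "real_distribution P" "real_distribution Q"
    and int: "\<And>k. integrable P (\<lambda>x. x ^ k)" "\<And>k. integrable Q (\<lambda>x. x ^ k)"
    and eq: "\<And>j. j < n \<Longrightarrow> (LINT x|P. x ^ (2 * j)) = (LINT x|Q. x ^ (2 * j))"
    and neq: "(LINT x|P. x ^ (2 * n)) \<noteq> (LINT x|Q. x ^ (2 * n))"
  obtains s b d :: real where "\<bar>s\<bar> = 1" "b > 0" "d > 0"
    "\<And>t. \<bar>t\<bar> \<le> d \<Longrightarrow> s * (Re (char P t) - Re (char Q t)) \<ge> b * t ^ (2 * n)"
proof -
  interpret P: real_distribution P by fact
  interpret Q: real_distribution Q by fact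
  define a where "a j = (-1) ^ j / fact (2 * j) * ((LINT x|P. x ^ (2 * j)) - (LINT x|Q. x ^ (2 * j)))" for j
  \<comment> \<open>\<open>L\<close> collects the remainders of both expansions; \<open>K\<close>
    also absorbs the Taylor term of index \<open>Suc n\<close>.\<close>
  define L where "L = 2 / fact (2 * Suc n) * ((LINT x|P. x ^ (2 * Suc n)) + (LINT x|Q. x ^ (2 * Suc n)))"
  define K where "K = L + \<bar>a (Suc n)\<bar>"
  have an: "a n \<noteq> 0" using neq by (simp add: a_def)
  have "L \<ge> 0"
    unfolding L_def by (intro mult_nonneg_nonneg add_nonneg_nonneg integral_nonneg) (auto simp: power_mult simp del: mult_Suc_right)
  then have K: "K \<ge> 0" by (simp add: K_def)
  have approx: "\<bar>Re (char P t) - Re (char Q t) - a n * t ^ (2 * n)\<bar> \<le> K * t ^ (2 * Suc n)" for t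
  proof -
    let ?p = "\<lambda>j. (-1) ^ j * t ^ (2 * j) / fact (2 * j) * (LINT x|P. x ^ (2 * j))"
    let ?q = "\<lambda>j. (-1) ^ j * t ^ (2 * j) / fact (2 * j) * (LINT x|Q. x ^ (2 * j))"
    have "(\<Sum>j\<le>Suc n. ?p j) - (\<Sum>j\<le>Suc n. ?q j) = (\<Sum>j\<le>Suc n. a j * t ^ (2 * j))"
      unfolding sum_subtractf[symmetric] by (intro sum.cong) (auto simp: a_def algebra_simps simp del: mult_Suc_right)
    also have "\<dots> = (\<Sum>j<n. a j * t ^ (2 * j)) + a n * t ^ (2 * n) + a (Suc n) * t ^ (2 * Suc n)"
      by (simp add: lessThan_Suc_atMost[symmetric] del: mult_Suc_right)
    also have "(\<Sum>j<n. a j * t ^ (2 * j)) = 0"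
      by (intro sum.neutral) (simp add: a_def eq)
    finally have sums: "(\<Sum>j\<le>Suc n. ?p j) - (\<Sum>j\<le>Suc n. ?q j) = a n * t ^ (2 * n) + a (Suc n) * t ^ (2 * Suc n)"
      by simp
    have pos: "t ^ (2 * Suc n) \<ge> 0" by (simp add: power_mult del: mult_Suc_right)
    have "\<bar>a (Suc n) * t ^ (2 * Suc n)\<bar> = \<bar>a (Suc n)\<bar> * t ^ (2 * Suc n)"
      using pos by (simp only: abs_mult abs_of_nonneg)
    moreover have "K * t ^ (2 * Suc n) = 2 * t ^ (2 * Suc n) / fact (2 * Suc n) * (LINT x|P. x ^ (2 * Suc n))
        + 2 * t ^ (2 * Suc n) / fact (2 * Suc n) * (LINT x|Q. x ^ (2 * Suc n)) + \<bar>a (Suc n)\<bar> * t ^ (2 * Suc n)"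
      unfolding K_def L_def by (simp add: algebra_simps del: mult_Suc_right fact_Suc power_Suc)
    ultimately show ?thesis
      using P.Re_char_approx[OF int(1), of t "Suc n"] Q.Re_char_approx[OF int(2), of t "Suc n"] sums
      by (smt (verit))
  qed
  \<comment> \<open>For \<open>\<bar>t\<bar> \<le> d\<close> this gives
    \<open>K * t\<^sup>2 \<le> \<bar>a n\<bar> / 2\<close>, so the error consumes at most half of
    the leading term.\<close>
  define d where "d = min 1 (\<bar>a n\<bar> / (2 * (K + 1)))"
  have d: "d > 0" "d \<le> 1" using an K by (auto simp: d_def)
  have "\<bar>a n\<bar> / 2 * t ^ (2 * n) \<le> sgn (a n) * (Re (char P t) - Re (char Q t))" if "\<bar>t\<bar> \<le> d" for t
  proof -
    have "t\<^sup>2 \<le> d\<^sup>2" using that by (metis abs_ge_zero power2_abs power_mono)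
    also have "\<dots> \<le> d" using d by (simp add: power2_eq_square mult_le_cancel_left1)
    also have "\<dots> \<le> \<bar>a n\<bar> / (2 * (K + 1))" by (simp add: d_def)
    finally have "K * t\<^sup>2 \<le> K * (\<bar>a n\<bar> / (2 * (K + 1)))" using K by (rule mult_left_mono)
    also have "\<dots> \<le> \<bar>a n\<bar> / 2" using K by (simp add: field_simps)
    finally have "K * t\<^sup>2 * t ^ (2 * n) \<le> \<bar>a n\<bar> / 2 * t ^ (2 * n)"
      by (rule mult_right_mono) (simp add: power_mult)
    then have err: "K * t ^ (2 * Suc n) \<le> \<bar>a n\<bar> / 2 * t ^ (2 * n)"
      by (simp add: power2_eq_square mult.assoc)
    let ?h = "Re (char P t) - Re (char Q t)"
    have "sgn (a n) * ?h = \<bar>a n\<bar> * t ^ (2 * n) + sgn (a n) * (?h - a n * t ^ (2 * n))"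
      by (simp add: right_diff_distrib abs_sgn mult.commute mult.left_commute)
    moreover have "\<bar>sgn (a n) * (?h - a n * t ^ (2 * n))\<bar> = \<bar>?h - a n * t ^ (2 * n)\<bar>"
      using an by (simp add: abs_mult abs_sgn_eq)
    ultimately show ?thesis using approx[of t] err by linarith
  qed
  with an d that[of "sgn (a n)" "\<bar>a n\<bar> / 2" d] show thesis
    by (simp add: abs_sgn_eq)
qed

text \<open>Equal even moments give equal Taylor polynomials and equal remainder bounds
  \<open>2 * (X ^ n / fact n)\<close>, which vanish as \<open>n\<close> grows.\<close>

lemma Re_char_eq_gaussian:
  assumes "real_distribution P" and int: "\<And>k. integrable P (\<lambda>x. x ^ k)"
    and eq: "\<And>n. (LINT x|P. x ^ (2 * n)) = (LINT x|gaussian \<sigma>. x ^ (2 * n))"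
  shows "Re (char P t) = Re (char (gaussian \<sigma>) t)"
proof -
  interpret P: real_distribution P by fact
  interpret G: real_distribution "gaussian \<sigma>" by (rule real_distribution_gaussian)
  define X where "X = \<sigma>\<^sup>2 / 2 * t\<^sup>2"
  have "\<bar>Re (char P t) - Re (char (gaussian \<sigma>) t)\<bar> \<le> 4 * (X ^ n / fact n)" for n
  proof -
    have "2 * t ^ (2 * n) / fact (2 * n) * (LINT x|gaussian \<sigma>. x ^ (2 * n)) = 2 * (X ^ n / fact n)"
      unfolding gaussian_even_moment X_def power_mult_distrib by (simp add: power_mult)
    with P.Re_char_approx[OF int, of t n] G.Re_char_approx[OF integrable_gaussian_power, of t n]
    show ?thesis unfolding eq by linarith
  qed
  moreover have "(\<lambda>n. 4 * (X ^ n / fact n)) \<longlonglongrightarrow> 4 * 0"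
  proof (rule tendsto_mult_left)
    show "(\<lambda>n. X ^ n / fact n) \<longlonglongrightarrow> 0"
      using summable_LIMSEQ_zero[OF summable_exp[of X]] by (simp add: field_simps)
  qed
  ultimately have "\<bar>Re (char P t) - Re (char (gaussian \<sigma>) t)\<bar> \<le> 4 * 0"
    by (intro LIMSEQ_le_const[of _ "4 * 0"]) blast+
  then show ?thesis by simp
qed

section \<open>From measure-valued solutions to the real equation, and oddness of the
  deviation\<close>

lemma kac_solution_real_kac:
  assumes "real_distribution \<mu>\<^sub>0" and int: "\<And>k. integrable \<mu>\<^sub>0 (\<lambda>x. x ^ k)"
    and sol: "kac_solution \<mu>\<^sub>0 \<mu>"
  shows "real_kac (\<lambda>\<xi> t. Re (char (\<mu> t) \<xi>)) (3 / 2 * (LINT x|\<mu>\<^sub>0. x\<^sup>2))"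
proof
  interpret M: real_distribution \<mu>\<^sub>0 by fact
  have dist: "real_distribution (\<mu> t)" if "t \<ge> 0" for t
    using sol that by (simp add: kac_solution_def)
  show "3 / 2 * (LINT x|\<mu>\<^sub>0. x\<^sup>2) \<ge> 0" by simp
  \<comment> \<open>The constant 3/2 is 1/2 from the quadratic Taylor term plus 1 from the remainder
    at \<open>n = 1\<close>.\<close>
  show "1 - Re (char (\<mu> 0) \<xi>) \<le> 3 / 2 * (LINT x|\<mu>\<^sub>0. x\<^sup>2) * \<xi>\<^sup>2" for \<xi>
  proof -
    have "char (\<mu> 0) \<xi> = char \<mu>\<^sub>0 \<xi>"
      using sol by (simp add: kac_solution_def kac_equation_def)
    then show ?thesis
      using M.Re_char_approx[OF int, of \<xi> 1]
      by (simp add: M.prob_space[unfolded M.space_eq_univ] abs_le_iff algebra_simps flip: power2_eq_square)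
  qed
  fix t :: real assume t: "t \<ge> 0"
  interpret T: real_distribution "\<mu> t" using dist[OF t] .
  show "continuous_on UNIV (\<lambda>\<xi>. Re (char (\<mu> t) \<xi>))"
    by (intro continuous_intros T.continuous_on_char)
  show "\<bar>Re (char (\<mu> t) \<xi>)\<bar> \<le> 1" for \<xi>
    using abs_Re_le_cmod T.cmod_char_le_1 order_trans by blast
  show "((\<lambda>t. Re (char (\<mu> t) \<xi>)) has_real_derivative
      circle_avg (\<lambda>\<theta>. Re (char (\<mu> t) (\<xi> * cos \<theta>)) * Re (char (\<mu> t) (\<xi> * sin \<theta>)))
        - Re (char (\<mu> t) \<xi>)) (at t within {0..})" for \<xi>
  proof -
    have "((\<lambda>s. char (\<mu> s) \<xi>) has_vector_derivative
        kac_star (char (\<mu> t)) (char (\<mu> t)) \<xi> - char (\<mu> t) \<xi>) (at t within {0..})"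
      using sol t by (simp add: kac_solution_def kac_equation_def)
    from bounded_linear.has_vector_derivative[OF bounded_linear_Re this]
    show ?thesis
      by (simp add: has_real_derivative_iff_has_vector_derivative T.Re_kac_star_char)
  qed
qed

theorem proposition2p4:
  fixes \<mu>\<^sub>0 :: "real measure" and \<mu> :: "real \<Rightarrow> real measure" and \<sigma> C :: real
  assumes "real_distribution \<mu>\<^sub>0"
    and "\<And>n::nat. integrable \<mu>\<^sub>0 (\<lambda>x. \<bar>x\<bar> ^ n)"
    and "\<sigma>\<^sup>2 = (LINT x|\<mu>\<^sub>0. x\<^sup>2)"
    and "kac_solution \<mu>\<^sub>0 \<mu>"
    and "C > 0"
    and "\<And>t. t \<ge> 0 \<Longrightarrow> d_TV (\<mu> t) (gaussian \<sigma>) \<le> C * exp (- t)"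
  shows "\<exists>osig :: real set \<Rightarrow> real.
           finite_signed_measure borel osig \<and>
           (\<forall>A\<in>sets borel. measure \<mu>\<^sub>0 A = measure (gaussian \<sigma>) A + osig A) \<and>
           (\<forall>A\<in>sets borel. osig A = - osig (uminus ` A) \<and> measure (gaussian \<sigma>) A + osig A \<ge> 0)"
proof -
  interpret M: real_distribution \<mu>\<^sub>0 by fact
  interpret G: real_distribution "gaussian \<sigma>" by (rule real_distribution_gaussian)
  have int: "integrable \<mu>\<^sub>0 (\<lambda>x. x ^ k)" for k
    using assms(2)[of k] by (rule Bochner_Integration.integrable_bound) (auto simp: power_abs)
  interpret real_kac "\<lambda>\<xi> t. Re (char (\<mu> t) \<xi>)" "3 / 2 * (LINT x|\<mu>\<^sub>0. x\<^sup>2)"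
    by (rule kac_solution_real_kac) (fact assms int)+
  have init_char: "char (\<mu> 0) \<xi> = char \<mu>\<^sub>0 \<xi>" for \<xi>
    using assms(4) by (simp add: kac_solution_def kac_equation_def)
  have decay: "\<bar>Re (char (\<mu> t) \<xi>) - exp (- (\<sigma>\<^sup>2 / 2 * \<xi>\<^sup>2))\<bar> \<le> 2 * C * exp (- t)" if "t \<ge> 0" for \<xi> t
  proof -
    have "real_distribution (\<mu> t)" using assms(4) that by (simp add: kac_solution_def)
    from Re_char_diff_le_d_TV[OF this real_distribution_gaussian, of \<xi> \<sigma>] assms(6)[OF that]
    show ?thesis by (simp add: char_gaussian)
  qed
  \<comment> \<open>Strong induction supplies agreement of all lower even moments, so a disagreement
    at \<open>n\<close> would be the leading term that \<open>slow_decay\<close> excludes.\<close>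
  have moments: "(LINT x|\<mu>\<^sub>0. x ^ (2 * n)) = (LINT x|gaussian \<sigma>. x ^ (2 * n))" for n
  proof (induction n rule: less_induct)
    case (less n)
    show ?case
    proof (rule ccontr)
      assume "\<not> ?case"
      then obtain s b d :: real where "\<bar>s\<bar> = 1" "b > 0" "d > 0"
        and "\<And>t. \<bar>t\<bar> \<le> d \<Longrightarrow> s * (Re (char \<mu>\<^sub>0 t) - Re (char (gaussian \<sigma>) t)) \<ge> b * t ^ (2 * n)"
        using Re_char_diff_leading_term[OF M.real_distribution_axioms G.real_distribution_axioms
            int integrable_gaussian_power less.IH] by metis
      then show False
        using slow_decay[of "\<sigma>\<^sup>2 / 2" b d s n "2 * C"] decay by (simp add: init_char char_gaussian)
    qed
  qed
  have Re_eq: "Re (char \<mu>\<^sub>0 t) = Re (char (gaussian \<sigma>) t)" for t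
    by (rule Re_char_eq_gaussian[OF assms(1) int moments])
  \<comment> \<open>With the difference as the signed measure, oddness is the equality of
    symmetrizations, and nonnegativity of the sum is that of the initial measure.\<close>
  define osig where "osig A = measure \<mu>\<^sub>0 A - measure (gaussian \<sigma>) A" for A
  have "finite_signed_measure borel osig"
    unfolding finite_signed_measure_def osig_def
    by (auto intro!: sums_diff M.finite_measure_UNION G.finite_measure_UNION)
  moreover have "osig A = - osig (uminus ` A)" if "A \<in> sets borel" for A
    using Re_char_eq_imp_measure_sum_eq[OF assms(1) real_distribution_gaussian Re_eq that]
    by (simp add: osig_def)
  moreover have "measure \<mu>\<^sub>0 A = measure (gaussian \<sigma>) A + osig A" for A
    by (simp add: osig_def)
  ultimately show ?thesis
    by (metis measure_nonneg)
qed

end
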